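(* Let $\mathcal{P}$ be a finite index set, $\{A_p : p\in\mathcal{P}\}$ a collection of real $n\times n$ matrices, each either stable or unstable, and $\mathcal{I}=\{I_q : q\in\mathcal{Q}\}$ a compact set of real $n\times n$ matrices. Suppose there exist a collection of symmetric positive definite matrices $\{Q_p\in M_n(\mathbb{R}) : p\in\mathcal{P}\}$ and constants $\lambda_p>0$ for $p\in\mathfrak{s}$, $\mu_p>0$ for $p\in\mathfrak{u}$, and $\gamma_{(p,q)}\ge1$ for $p,q\in\mathcal{P}$ satisfying $$Q_pA_p+A_p^\top Q_p\le-\lambda_pQ_p\ \text{ for all }p\in\mathfrak{s},\qquad Q_pA_p+A_p^\top Q_p\le\mu_pQ_p\ \text{ for all }p\in\mathfrak{u},$$ $$M^\top Q_pM\le\gamma_{(q,p)}Q_q\ \text{ for all }p,q\in\mathcal{P}\text{ and }M\in\mathcal{I}.$$ Let $\lambda=\min_{p\in\mathfrak{s}}\lambda_p$, $\mu=\max_{p\in\mathfrak{u}}\mu_p$ and $\gamma=\max_{p,q\in\mathcal{P}}\gamma_{(p,q)}$. Let $\tau,\eta>0$. Then for any signal $\sigma\in\mathcal{S}[\tau,\eta]$ satisfying $$\limsup_{t\to\infty}\left(-\lambda\,N_s(0,t)\,\tau+\mu\,N_u(0,t)\,\eta+N(0,t)\ln\gamma\right)<0,$$ the impulsive switched system $\dot x(t)=A_{\sigma(t)}x(t)$, $x(t_k)=I_{\omega(t_k)}\,x(t_k^-)$ ($k\ge1$) is stable under arbitrary impulses, i.e. stable for every function $\omega:\{t_1,t_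2,\dots\}\to\mathcal{Q}$.
   Context: A real matrix is called stable if all its eigenvalues have negative real part, and unstable if at least one eigenvalue has positive real part; $\mathfrak{s},\mathfrak{u}\subseteq\mathcal{P}$ are the sets of indices $p$ with $A_p$ stable, resp. unstable. For symmetric matrices, $\le$ denotes the Loewner order. A switching signal is a right-continuous piecewise constant function $\sigma:[0,\infty)\to\mathcal{P}$ whose set of discontinuities $\{t_k\}_{k\ge1}$ (switching times) is an increasing sequence with $t_k\uparrow\infty$; put $t_0=0$. $\mathcal{S}[\tau,\eta]$ is the set of switching signals such that for all $k\ge1$: $t_k-t_{k-1}\ge\tau$ if $\sigma(t_{k-1})\in\mathfrak{s}$, and $t_k-t_{k-1}\le\eta$ if $\sigma(t_{k-1})\in\mathfrak{u}$. Define $N_s(0,t)=\#\{i : 0\le t_i<t,\ \sigma(t_i)\in\mathfrak{s}\}$, $N_u(0,t)=\#\{i : 0\le t_i<t,\ \sigma(t_i)\in\mathfrak{u}\}$, $N(0,t)=N_s(0,t)+N_u(0,t)$. (If $\mathfrak{s}$ or $\mathfrak{u}$ is empty, the term with $\lambda$, resp. $\mu$, is zero.) In the impulsive switched system, $\dot x=A_{\sigma(t)}x$ holds on each $[t_{k-1},t_k)$ and $x(t_k^-)=\lim_{t\to t_k^-}x(t)$. The system (for fixed $\sigma,\omega$) is stable if for every $\epsilon>0$ there is $\delta>0$ such that $\|x(0)\|<\delta$ implies $\|x(t)\|<\epsilon$ for all $t>0$ (Euclidean norm). *)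

theory Defs
  imports "HOL-Analysis.Analysis"
begin

text \<open>The eigenvalues of a real matrix are taken over the complex numbers.\<close>

definition eigenvalues :: "real^'n^'n \<Rightarrow> complex set" where
  "eigenvalues A = {z. \<exists>v::complex^'n. v \<noteq> 0 \<and> map_matrix complex_of_real A *v v = z *s v}"

definition stable_matrix :: "real^'n^'n \<Rightarrow> bool" where
  "stable_matrix A \<longleftrightarrow> (\<forall>z\<in>eigenvalues A. Re z < 0)"

definition unstable_matrix :: "real^'n^'n \<Rightarrow> bool" where
  "unstable_matrix A \<longleftrightarrow> (\<exists>z\<in>eigenvalues A. Re z > 0)"

definition stable_idx :: "'p set \<Rightarrow> ('p \<Rightarrow> real^'n^'n) \<Rightarrow> 'p set" where
  "stable_idx P A = {p\<in>P. stable_matrix (A p)}"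

definition unstable_idx :: "'p set \<Rightarrow> ('p \<Rightarrow> real^'n^'n) \<Rightarrow> 'p set" where
  "unstable_idx P A = {p\<in>P. unstable_matrix (A p)}"

definition pos_def :: "real^'n^'n \<Rightarrow> bool" where
  "pos_def M \<longleftrightarrow> transpose M = M \<and> (\<forall>v. v \<noteq> 0 \<longrightarrow> v \<bullet> (M *v v) > 0)"

definition pos_semidef :: "real^'n^'n \<Rightarrow> bool" where
  "pos_semidef M \<longleftrightarrow> transpose M = M \<and> (\<forall>v. v \<bullet> (M *v v) \<ge> 0)"

definition loewner_le :: "real^'n^'n \<Rightarrow> real^'n^'n \<Rightarrow> bool" (infix "\<preceq>" 50) where
  "A \<preceq> B \<longleftrightarrow> pos_semidef (B - A)"

text \<open>Signals are functions on the reals of which only the values on \<open>[0,\<infinity>)\<close> matter. The index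
  set carries the discrete topology, so continuity means being locally constant.\<close>

definition discontinuities :: "(real \<Rightarrow> 'p) \<Rightarrow> real set" where
  "discontinuities \<sigma> = {s\<in>{0..}. \<not> (\<forall>\<^sub>F r in at s within {0..}. \<sigma> r = \<sigma> s)}"

text \<open>\<open>\<sigma>\<close> is a switching signal with switching times \<open>T 1 < T 2 < \<dots>\<close>, where \<open>T 0 = 0\<close> is not
  itself a switching time. The sequence \<open>T\<close> is uniquely determined by \<open>\<sigma>\<close>.\<close>

definition switching_signal :: "'p set \<Rightarrow> (real \<Rightarrow> 'p) \<Rightarrow> (nat \<Rightarrow> real) \<Rightarrow> bool" where
  "switching_signal P \<sigma> T \<longleftrightarrow>
     \<sigma> ` {0..} \<subseteq> P \<and>
     T 0 = 0 \<and> strict_mono T \<and> filterlim T at_top sequentially \<and>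
     discontinuities \<sigma> = T ` {1..} \<and>
     (\<forall>s\<ge>0. \<forall>\<^sub>F r in at_right s. \<sigma> r = \<sigma> s) \<and>
     (\<forall>k. \<sigma> constant_on {T k<..<T (Suc k)})"

definition signal_class ::
  "'p set \<Rightarrow> ('p \<Rightarrow> real^'n^'n) \<Rightarrow> real \<Rightarrow> real \<Rightarrow> ((real \<Rightarrow> 'p) \<times> (nat \<Rightarrow> real)) set" where
  "signal_class P A \<tau> \<eta> = {(\<sigma>, T). switching_signal P \<sigma> T \<and>
     (\<forall>k\<ge>1. (\<sigma> (T (k - 1)) \<in> stable_idx P A \<longrightarrow> T k - T (k - 1) \<ge> \<tau>) \<and>
            (\<sigma> (T (k - 1)) \<in> unstable_idx P A \<longrightarrow> T k - T (k - 1) \<le> \<eta>))}"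

definition visits :: "(real \<Rightarrow> 'p) \<Rightarrow> (nat \<Rightarrow> real) \<Rightarrow> 'p set \<Rightarrow> real \<Rightarrow> nat" where
  "visits \<sigma> T S t = card {i. 0 \<le> T i \<and> T i < t \<and> \<sigma> (T i) \<in> S}"

text \<open>At a left endpoint \<open>T (k - 1)\<close> the equation holds for the right derivative.\<close>

definition trajectory ::
  "('p \<Rightarrow> real^'n^'n) \<Rightarrow> ('q \<Rightarrow> real^'n^'n) \<Rightarrow> (real \<Rightarrow> 'p) \<Rightarrow> (nat \<Rightarrow> real) \<Rightarrow> (real \<Rightarrow> 'q)
    \<Rightarrow> (real \<Rightarrow> real^'n) \<Rightarrow> bool" where
  "trajectory A J \<sigma> T \<omega> x \<longleftrightarrow>
     (\<forall>k\<ge>1. \<forall>t\<in>{T (k - 1)..<T k}.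
        (x has_vector_derivative A (\<sigma> t) *v x t) (at t within {T (k - 1)..<T k})) \<and>
     (\<forall>k\<ge>1. \<exists>l. (x \<longlongrightarrow> l) (at_left (T k)) \<and> x (T k) = J (\<omega> (T k)) *v l)"

definition stable_system ::
  "('p \<Rightarrow> real^'n^'n) \<Rightarrow> ('q \<Rightarrow> real^'n^'n) \<Rightarrow> (real \<Rightarrow> 'p) \<Rightarrow> (nat \<Rightarrow> real) \<Rightarrow> (real \<Rightarrow> 'q)
    \<Rightarrow> bool" where
  "stable_system A J \<sigma> T \<omega> \<longleftrightarrow>
     (\<forall>\<epsilon>>0. \<exists>\<delta>>0. \<forall>x. trajectory A J \<sigma> T \<omega> x \<longrightarrow> norm (x 0) < \<delta> \<longrightarrow> (\<forall>t>0. norm (x t) < \<epsilon>))"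

text \<open>Stability for every impulse function \<open>\<omega>\<close> from the switching times to \<open>Q\<close>.\<close>

definition stable_under_arbitrary_impulses ::
  "('p \<Rightarrow> real^'n^'n) \<Rightarrow> 'q set \<Rightarrow> ('q \<Rightarrow> real^'n^'n) \<Rightarrow> (real \<Rightarrow> 'p) \<Rightarrow> (nat \<Rightarrow> real) \<Rightarrow> bool" where
  "stable_under_arbitrary_impulses A Q J \<sigma> T \<longleftrightarrow>
     (\<forall>\<omega>. \<omega> ` T ` {1..} \<subseteq> Q \<longrightarrow> stable_system A J \<sigma> T \<omega>)"

text \<open>The quantity
  \<open>-\<lambda> N\<^sub>s(0,t) \<tau> + \<mu> N\<^sub>u(0,t) \<eta> + N(0,t) ln \<gamma>\<close> with \<open>\<lambda>\<close> the minimum of \<open>lam\<close>, \<open>\<mu>\<close> the maximum of \<open>mu\<close>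
  and \<open>\<gamma>\<close> the maximum of \<open>gam\<close>. If there is no stable (unstable) index, then \<open>N\<^sub>s = 0\<close>
  (\<open>N\<^sub>u = 0\<close>), so the corresponding term vanishes whatever value \<open>Min {}\<close> (\<open>Max {}\<close>) has.\<close>

definition growth_exponent ::
  "'p set \<Rightarrow> ('p \<Rightarrow> real^'n^'n) \<Rightarrow> ('p \<Rightarrow> real) \<Rightarrow> ('p \<Rightarrow> real) \<Rightarrow> ('p \<times> 'p \<Rightarrow> real) \<Rightarrow> real \<Rightarrow> real
    \<Rightarrow> (real \<Rightarrow> 'p) \<Rightarrow> (nat \<Rightarrow> real) \<Rightarrow> real \<Rightarrow> real" where
  "growth_exponent P A lam mu gam \<tau> \<eta> \<sigma> T t =
     (let Ns = visits \<sigma> T (stable_idx P A) t;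
          Nu = visits \<sigma> T (unstable_idx P A) t
      in - Min (lam ` stable_idx P A) * real Ns * \<tau>
         + Max (mu ` unstable_idx P A) * real Nu * \<eta>
         + real (Ns + Nu) * ln (Max (gam ` (P \<times> P))))"

end

theory Submission
  imports Defs
begin

text \<open>The function \<open>V t = x t \<bullet> (Qm (\<sigma> t) *v x t)\<close> is a multiple Lyapunov function. On the interval
  between two switching times it grows at most at the exponential rate of the active index, and an
  impulse multiplies it by at most \<open>\<gamma>\<close>. Hence \<open>V (T k) \<le> exp (G (T k)) * V 0\<close>, where \<open>G\<close> is the growth
  exponent. The sequence \<open>G (T k)\<close> is bounded above because its limsup is negative, and \<open>V\<close> is
  comparable with the squared norm uniformly over the finitely many indices.\<close>

section \<open>Quadratic forms and the Loewner order\<close>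

definition qform :: "real^'n^'n \<Rightarrow> real^'n \<Rightarrow> real" where
  "qform M v = v \<bullet> (M *v v)"

lemma qform_0 [simp]: "qform M 0 = 0"
  by (simp add: qform_def)

lemma qform_scaleR_left [simp]: "qform (c *\<^sub>R M) v = c * qform M v"
  by (simp add: qform_def scaleR_matrix_vector_assoc [symmetric])

lemma qform_scaleR_right: "qform M (c *\<^sub>R v) = c\<^sup>2 * qform M v"
  by (simp add: qform_def matrix_vector_mult_scaleR power2_eq_square)

lemma inner_transpose_mult: "v \<bullet> (transpose M *v w) = (M *v v) \<bullet> w" for M :: "real^'n^'m"
  by (metis dot_lmul_matrix inner_commute transpose_matrix_vector)

text \<open>Moves an impulse from the argument into the matrix: the form of the new index after the
  jump becomes a form in the left limit, where the hypothesis on \<open>gam\<close> applies.\<close>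

lemma qform_congruence: "qform (transpose M ** N ** M) v = qform N (M *v v)"
proof -
  have "(transpose M ** N ** M) *v v = transpose M *v (N *v (M *v v))"
    by (simp add: matrix_vector_mul_assoc matrix_mul_assoc)
  then show ?thesis
    by (simp add: qform_def inner_transpose_mult del: transpose_matrix_vector)
qed

text \<open>The right-hand side is the product-rule derivative of \<open>qform N\<close> along
  \<open>x' = M x\<close> at \<open>v\<close>, so a Loewner bound on the Lyapunov expression bounds
  that derivative.\<close>

lemma qform_lyapunov: "qform (N ** M + transpose M ** N) v = v \<bullet> (N *v (M *v v)) + (M *v v) \<bullet> (N *v v)"
  by (simp add: qform_def matrix_vector_mult_add_rdistrib inner_add_right matrix_vector_mul_assoc [symmetric]
      inner_transpose_mult del: transpose_matrix_vector)

lemma loewner_le_qform: "M \<preceq> N \<Longrightarrow> qform M v \<le> qform N v"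
  by (auto simp: loewner_le_def pos_semidef_def qform_def matrix_vector_mult_diff_rdistrib inner_diff_right)

lemma pos_def_qform_nonneg: "pos_def M \<Longrightarrow> 0 \<le> qform M v"
  by (cases "v = 0") (auto simp: pos_def_def qform_def less_imp_le)

lemma continuous_on_qform: "continuous_on S (qform M)"
  unfolding qform_def
  by (intro continuous_intros linear_continuous_on) (simp add: linear_linear)

lemma tendsto_qform:
  assumes "(f \<longlongrightarrow> l) F"
  shows "((\<lambda>t. qform M (f t)) \<longlongrightarrow> qform M l) F"
  using continuous_on_tendsto_compose [OF continuous_on_qform [of UNIV M] assms] by simp

lemma qform_has_real_derivative:
  assumes "(x has_vector_derivative x') (at t)"
  shows "((\<lambda>t. qform M (x t)) has_real_derivative (x t \<bullet> (M *v x') + x' \<bullet> (M *v x t))) (at t)"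
proof -
  have "((\<lambda>t. M *v x t) has_vector_derivative M *v x') (at t)"
    by (rule bounded_linear.has_vector_derivative [OF _ assms]) (simp add: linear_linear)
  from bounded_bilinear.has_vector_derivative [OF bounded_bilinear_inner assms this]
  show ?thesis
    by (simp add: qform_def has_real_derivative_iff_has_vector_derivative)
qed

section \<open>Comparison of quadratic forms with the squared norm\<close>

lemma qform_upper_bound: "\<exists>b>0. \<forall>v. qform M v \<le> b * (norm v)\<^sup>2"
proof -
  have "bounded_linear ((*v) M)"
    by (simp add: linear_linear)
  then obtain b where b: "b > 0" "\<And>v. norm (M *v v) \<le> norm v * b"
    using bounded_linear.pos_bounded by blast
  have "qform M v \<le> b * (norm v)\<^sup>2" for v
  proof -
    have "qform M v \<le> norm v * norm (M *v v)"
      unfolding qform_def by (rule norm_cauchy_schwarz)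
    also have "\<dots> \<le> norm v * (norm v * b)"
      by (intro mult_left_mono b) simp
    finally show ?thesis
      by (simp add: power2_eq_square mult_ac)
  qed
  with b show ?thesis by blast
qed

text \<open>The form attains a minimum on the compact unit sphere, which definiteness makes
  positive; homogeneity of degree two carries it over to all vectors.\<close>

lemma pos_def_qform_lower_bound:
  fixes M :: "real^'n^'n"
  assumes "pos_def M"
  shows "\<exists>a>0. \<forall>v. a * (norm v)\<^sup>2 \<le> qform M v"
proof -
  have "compact (sphere (0::real^'n) 1)" "sphere (0::real^'n) 1 \<noteq> {}"
    by auto
  from continuous_attains_inf [OF this continuous_on_qform]
  obtain u where u: "norm u = 1" "\<And>v. norm v = 1 \<Longrightarrow> qform M u \<le> qform M v"
    by force
  have "qform M u > 0"
    using assms u(1) unfolding pos_def_def qform_def by (metis norm_zero zero_neq_one)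
  moreover have "qform M u * (norm v)\<^sup>2 \<le> qform M v" for v
  proof (cases "v = 0")
    case False
    have "qform M v = (norm v)\<^sup>2 * qform M ((1 / norm v) *\<^sub>R v)"
      using False by (simp add: qform_scaleR_right power_divide)
    moreover have "qform M u \<le> qform M ((1 / norm v) *\<^sub>R v)"
      using False by (intro u(2)) simp
    ultimately show ?thesis
      by (metis mult.commute mult_left_mono zero_le_power2)
  qed simp
  ultimately show ?thesis by blast
qed

lemma pos_def_uniform_bounds:
  fixes M :: "'p \<Rightarrow> real^'n^'n"
  assumes "finite P" and "\<And>p. p \<in> P \<Longrightarrow> pos_def (M p)"
  shows "\<exists>a>0. \<exists>b>0. \<forall>p\<in>P. \<forall>v. a * (norm v)\<^sup>2 \<le> qform (M p) v \<and> qform (M p) v \<le> b * (norm v)\<^sup>2"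
  using assms
proof (induction P rule: finite_induct)
  case empty
  show ?case by (auto intro: exI [of _ 1])
next
  case (insert p P)
  then obtain a b where ab: "a > 0" "b > 0"
    "\<And>q v. q \<in> P \<Longrightarrow> a * (norm v)\<^sup>2 \<le> qform (M q) v \<and> qform (M q) v \<le> b * (norm v)\<^sup>2"
    by (metis insertCI)
  obtain a' where a': "a' > 0" "\<And>v. a' * (norm v)\<^sup>2 \<le> qform (M p) v"
    using pos_def_qform_lower_bound insert.prems by blast
  obtain b' where b': "b' > 0" "\<And>v. qform (M p) v \<le> b' * (norm v)\<^sup>2"
    using qform_upper_bound by blast
  have le: "min a a' * (norm v)\<^sup>2 \<le> a * (norm v)\<^sup>2" "min a a' * (norm v)\<^sup>2 \<le> a' * (norm v)\<^sup>2"
    "b * (norm v)\<^sup>2 \<le> max b b' * (norm v)\<^sup>2" "b' * (norm v)\<^sup>2 \<le> max b b' * (norm v)\<^sup>2" for v :: "real^'n"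
    by (auto intro: mult_right_mono)
  have "\<forall>q\<in>insert p P. \<forall>v. min a a' * (norm v)\<^sup>2 \<le> qform (M q) v \<and> qform (M q) v \<le> max b b' * (norm v)\<^sup>2"
    using order_trans [OF le(1) conjunct1 [OF ab(3)]] order_trans [OF le(2) a'(2)]
      order_trans [OF conjunct2 [OF ab(3)] le(3)] order_trans [OF b'(2) le(4)]
    by blast
  moreover have "min a a' > 0" "max b b' > 0"
    using ab a' b' by auto
  ultimately show ?case by blast
qed

section \<open>Exponential bound along the flow of a single index\<close>

lemma qform_flow_bound:
  assumes deriv: "\<And>t. t \<in> {a..<b} \<Longrightarrow> (x has_vector_derivative A *v x t) (at t within {a..<b})"
    and lyap: "M ** A + transpose A ** M \<preceq> c *\<^sub>R M"
    and t: "t \<in> {a..<b}"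
  shows "qform M (x t) \<le> exp (c * (t - a)) * qform M (x a)"
\<comment> \<open>Gronwall argument with an integrating factor: \<open>W\<close> is nonincreasing
  whatever the sign of \<open>c\<close>, so decay (\<open>c = - lam p\<close>) and growth
  (\<open>c = mu p\<close>) are treated alike.\<close>
proof -
  define W where "W s = exp (- c * (s - a)) * qform M (x s)" for s
  have "W t \<le> W a"
  \<comment> \<open>At \<open>a\<close> only a right derivative is available. The mean value
    argument therefore takes two-sided derivatives at interior points and mere continuity at the
    ends.\<close>
  proof (rule DERIV_nonpos_imp_decreasing_open [where f = W])
    fix s assume s: "a < s" "s < t"
    have "at s within {a..<b} = at s"
      using s t by (intro at_within_interior) simp
    with deriv [of s] s t have "(x has_vector_derivative A *v x s) (at s)"
      by simp
    from qform_has_real_derivative [OF this, of M]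
    have "((\<lambda>s. qform M (x s)) has_real_derivative qform (M ** A + transpose A ** M) (x s)) (at s)"
      by (simp add: qform_lyapunov)
    then have "(W has_real_derivative
        exp (- c * (s - a)) * (qform (M ** A + transpose A ** M) (x s) - c * qform M (x s))) (at s)"
      unfolding W_def by (auto intro!: derivative_eq_intros simp: algebra_simps)
    moreover have "qform (M ** A + transpose A ** M) (x s) - c * qform M (x s) \<le> 0"
      using loewner_le_qform [OF lyap, of "x s"] by simp
    ultimately show "\<exists>y. (W has_real_derivative y) (at s) \<and> y \<le> 0"
      by (metis exp_ge_zero mult_nonneg_nonpos)
  next
    have "continuous_on {a..<b} x"
      using deriv has_vector_derivative_continuous continuous_on_eq_continuous_within by blast
    then have "continuous_on {a..t} x"
      using t by (auto intro: continuous_on_subset)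
    then have "continuous_on {a..t} (\<lambda>s. qform M (x s))"
      by (intro continuous_on_compose2 [OF continuous_on_qform [of UNIV]]) auto
    then show "continuous_on {a..t} W"
      unfolding W_def by (intro continuous_intros)
  qed (use t in simp)
  then show ?thesis
    by (simp add: W_def exp_minus divide_simps mult_ac)
qed

section \<open>Switching intervals and visit counts\<close>

lemma stable_unstable_disjoint: "p \<in> stable_idx P A \<Longrightarrow> p \<notin> unstable_idx P A"
  by (force simp: stable_idx_def unstable_idx_def stable_matrix_def unstable_matrix_def)

text \<open>Constancy is given on the open interval; right-continuity at \<open>T k\<close> supplies
  a point inside it with value \<open>\<sigma> (T k)\<close>, which links the left endpoint to the
  rest.\<close>

lemma switching_signal_constant:
  assumes "switching_signal P \<sigma> T" and t: "t \<in> {T k..<T (Suc k)}"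
  shows "\<sigma> t = \<sigma> (T k)"
proof (cases "t = T k")
  case False
  have T: "T 0 = 0" "strict_mono T" and right: "\<And>s. s \<ge> 0 \<Longrightarrow> \<forall>\<^sub>F r in at_right s. \<sigma> r = \<sigma> s"
    and const: "\<sigma> constant_on {T k<..<T (Suc k)}"
    using assms(1) by (auto simp: switching_signal_def)
  have "T k \<ge> 0"
    using T by (metis strict_mono_less_eq zero_le)
  have lt: "T k < T (Suc k)"
    using T by (simp add: strict_mono_def)
  have "\<forall>\<^sub>F r in at_right (T k). r \<in> {T k<..<T (Suc k)}"
    using lt by (rule eventually_at_right_real)
  with right [OF \<open>T k \<ge> 0\<close>] have "\<forall>\<^sub>F r in at_right (T k). \<sigma> r = \<sigma> (T k) \<and> r \<in> {T k<..<T (Suc k)}"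
    by (rule eventually_conj)
  then obtain r where "\<sigma> r = \<sigma> (T k)" "r \<in> {T k<..<T (Suc k)}"
    using eventually_happens trivial_limit_at_right_real by blast
  moreover have "t \<in> {T k<..<T (Suc k)}"
    using t False by auto
  ultimately show ?thesis
    using const by (metis constant_on_def)
qed simp

text \<open>Since \<open>T\<close> is strictly increasing and the inequality in
  \<open>visits\<close> is strict, the count at \<open>T j\<close> runs over the indices
  \<open>i < j\<close>; going from \<open>T k\<close> to \<open>T (Suc k)\<close> admits just
  \<open>k\<close>.\<close>

lemma visits_Suc:
  assumes "switching_signal P \<sigma> T"
  shows "visits \<sigma> T S (T (Suc k)) = visits \<sigma> T S (T k) + (if \<sigma> (T k) \<in> S then 1 else 0)"
proof -
  have T: "T 0 = 0" "strict_mono T"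
    using assms by (auto simp: switching_signal_def)
  have "T i \<ge> 0" for i
    using T by (metis strict_mono_less_eq zero_le)
  then have eq: "{i. 0 \<le> T i \<and> T i < T j \<and> \<sigma> (T i) \<in> S} = {i. i < j \<and> \<sigma> (T i) \<in> S}" for j
    using T(2) by (auto simp: strict_mono_less)
  have "{i. i < Suc k \<and> \<sigma> (T i) \<in> S} =
      (if \<sigma> (T k) \<in> S then insert k {i. i < k \<and> \<sigma> (T i) \<in> S} else {i. i < k \<and> \<sigma> (T i) \<in> S})"
    by (auto simp: less_Suc_eq)
  then show ?thesis
    by (simp add: visits_def eq)
qed

lemma visits_0:
  assumes "switching_signal P \<sigma> T"
  shows "visits \<sigma> T S (T 0) = 0"
proof -
  have "{i. 0 \<le> T i \<and> T i < T 0 \<and> \<sigma> (T i) \<in> S} = {}"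
    using assms by (auto simp: switching_signal_def)
  then show ?thesis
    by (simp only: visits_def card.empty)
qed

text \<open>Worst-case logarithmic growth over one complete switching interval, with the impulse
  term left out.\<close>

definition step_exponent ::
  "'p set \<Rightarrow> ('p \<Rightarrow> real^'n^'n) \<Rightarrow> ('p \<Rightarrow> real) \<Rightarrow> ('p \<Rightarrow> real) \<Rightarrow> real \<Rightarrow> real \<Rightarrow> 'p \<Rightarrow> real" where
  "step_exponent P A lam mu \<tau> \<eta> p =
     (if p \<in> stable_idx P A then - Min (lam ` stable_idx P A) * \<tau> else Max (mu ` unstable_idx P A) * \<eta>)"

text \<open>The active index is in exactly one of the two classes, so exactly one of the two counts
  rises by one and the total count rises by one.\<close>

lemma growth_exponent_Suc:
  assumes "switching_signal P \<sigma> T" and "\<forall>p\<in>P. stable_matrix (A p) \<or> unstable_matrix (A p)"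
    and "\<sigma> (T k) \<in> P"
  shows "growth_exponent P A lam mu gam \<tau> \<eta> \<sigma> T (T (Suc k)) =
    growth_exponent P A lam mu gam \<tau> \<eta> \<sigma> T (T k) + step_exponent P A lam mu \<tau> \<eta> (\<sigma> (T k))
      + ln (Max (gam ` (P \<times> P)))"
proof (cases "\<sigma> (T k) \<in> stable_idx P A")
  case True
  with stable_unstable_disjoint [OF this] show ?thesis
    by (simp add: growth_exponent_def Let_def visits_Suc [OF assms(1)] step_exponent_def algebra_simps)
next
  case False
  then have "\<sigma> (T k) \<in> unstable_idx P A"
    using assms by (auto simp: stable_idx_def unstable_idx_def)
  with False show ?thesis
    by (simp add: growth_exponent_def Let_def visits_Suc [OF assms(1)] step_exponent_def algebra_simps)
qed

text \<open>A negative limsup makes the values at \<open>T k\<close> negative from some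
  \<open>K\<close> on; the finitely many earlier ones are bounded by their maximum.\<close>

lemma Limsup_neg_imp_bounded_sequence:
  fixes g :: "real \<Rightarrow> real"
  assumes "Limsup at_top (\<lambda>t. ereal (g t)) < 0" and "filterlim T at_top sequentially"
  shows "\<exists>C. \<forall>k::nat. g (T k) \<le> C"
proof -
  have "\<forall>\<^sub>F t in at_top. ereal (g t) < 0"
    using assms(1) by (rule Limsup_lessD)
  then have "\<forall>\<^sub>F k in sequentially. ereal (g (T k)) < 0"
    using assms(2) by (rule eventually_compose_filterlim)
  then obtain K where K: "\<And>k. k \<ge> K \<Longrightarrow> g (T k) < 0"
    by (auto simp: eventually_sequentially)
  have "g (T k) \<le> max 0 (Max ((\<lambda>k. g (T k)) ` {..K}))" for k
  proof (cases "k \<le> K")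
    case True
    then have "g (T k) \<le> Max ((\<lambda>k. g (T k)) ` {..K})"
      by (intro Max_ge) auto
    then show ?thesis by simp
  next
    case False
    with K [of k] show ?thesis by simp
  qed
  then show ?thesis by blast
qed

text \<open>The least index \<open>j\<close> with \<open>t < T j\<close> is nonzero because
  \<open>T 0 \<le> t\<close>; its predecessor is the wanted \<open>k\<close>.\<close>

lemma switching_interval_exists:
  fixes T :: "nat \<Rightarrow> real"
  assumes "T 0 \<le> t" and "filterlim T at_top sequentially"
  shows "\<exists>k. t \<in> {T k..<T (Suc k)}"
proof -
  have "\<exists>k. t < T k"
    using assms(2) by (auto simp: filterlim_at_top_dense eventually_sequentially)
  then have least: "t < T (LEAST k. t < T k)" "\<And>j. j < (LEAST k. t < T k) \<Longrightarrow> \<not> t < T j"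
    by (auto intro: LeastI_ex dest: not_less_Least)
  then obtain k where "(LEAST k. t < T k) = Suc k"
    using assms(1) by (metis not_less old.nat.exhaust)
  with least show ?thesis
    by (metis atLeastLessThan_iff lessI not_less)
qed

theorem theorem4p7:
  fixes P :: "'p set" and A Qm :: "'p \<Rightarrow> real^'n^'n"
    and Q :: "'q set" and J :: "'q \<Rightarrow> real^'n^'n"
    and lam mu :: "'p \<Rightarrow> real" and gam :: "'p \<times> 'p \<Rightarrow> real"
    and \<tau> \<eta> :: real and \<sigma> :: "real \<Rightarrow> 'p" and T :: "nat \<Rightarrow> real"
  assumes "finite P"
    and "\<forall>p\<in>P. stable_matrix (A p) \<or> unstable_matrix (A p)"
    and "compact (J ` Q)"
    and "\<forall>p\<in>P. pos_def (Qm p)"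
    and "\<forall>p\<in>stable_idx P A. lam p > 0"
    and "\<forall>p\<in>unstable_idx P A. mu p > 0"
    and "\<forall>p\<in>P. \<forall>q\<in>P. gam (p, q) \<ge> 1"
    and "\<forall>p\<in>stable_idx P A. Qm p ** A p + transpose (A p) ** Qm p \<preceq> (- lam p) *\<^sub>R Qm p"
    and "\<forall>p\<in>unstable_idx P A. Qm p ** A p + transpose (A p) ** Qm p \<preceq> mu p *\<^sub>R Qm p"
    and "\<forall>p\<in>P. \<forall>q\<in>P. \<forall>M\<in>J ` Q. transpose M ** Qm p ** M \<preceq> gam (q, p) *\<^sub>R Qm q"
    and "\<tau> > 0" and "\<eta> > 0"
    and "(\<sigma>, T) \<in> signal_class P A \<tau> \<eta>"
    and "Limsup at_top (\<lambda>t. ereal (growth_exponent P A lam mu gam \<tau> \<eta> \<sigma> T t)) < 0"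
  shows "stable_under_arbitrary_impulses A Q J \<sigma> T"
proof -
  have sig: "switching_signal P \<sigma> T"
    and dwell: "\<And>k. \<sigma> (T k) \<in> stable_idx P A \<Longrightarrow> \<tau> \<le> T (Suc k) - T k"
      "\<And>k. \<sigma> (T k) \<in> unstable_idx P A \<Longrightarrow> T (Suc k) - T k \<le> \<eta>"
    using assms(13) by (auto simp: signal_class_def dest!: spec [of _ "Suc _"])
  have T: "T 0 = 0" "strict_mono T" "filterlim T at_top sequentially" and \<sigma>P: "\<And>t. t \<ge> 0 \<Longrightarrow> \<sigma> t \<in> P"
    using sig by (auto simp: switching_signal_def)
  have T_nonneg: "T k \<ge> 0" for k
    using T(1,2) by (metis strict_mono_less_eq zero_le)
  have T_less: "T k < T (Suc k)" for k
    using T(2) by (simp add: strict_mono_def)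
  have \<sigma>TP: "\<sigma> (T k) \<in> P" for k
    by (simp add: \<sigma>P T_nonneg)
  define G where "G = growth_exponent P A lam mu gam \<tau> \<eta> \<sigma> T"
  define \<gamma> where "\<gamma> = Max (gam ` (P \<times> P))"
  define step where "step k = step_exponent P A lam mu \<tau> \<eta> (\<sigma> (T k))" for k
  \<comment> \<open>Bounds the exponent gained on an initial piece of a switching interval. The
    maximum with 0 covers stable indices, and the unspecified \<open>Max {}\<close> if there is no
    unstable index.\<close>
  define B where "B = max 0 (Max (mu ` unstable_idx P A) * \<eta>)"
  have gam_le: "gam (p, q) \<le> \<gamma>" if "p \<in> P" "q \<in> P" for p q
    unfolding \<gamma>_def using assms(1) that by (intro Max_ge) auto
  \<comment> \<open>\<open>P\<close> contains \<open>\<sigma> (T 0)\<close>, so the maximum is over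
    a nonempty set. Positivity later allows \<open>exp (ln \<gamma>)\<close> to be replaced by
    \<open>\<gamma>\<close>.\<close>
  have "\<gamma> \<ge> 1"
    using gam_le [OF \<sigma>TP \<sigma>TP, of 0 0] assms(7) \<sigma>TP [of 0] by force
  have G_Suc: "G (T (Suc k)) = G (T k) + step k + ln \<gamma>" for k
    unfolding G_def \<gamma>_def step_def by (rule growth_exponent_Suc [OF sig assms(2) \<sigma>TP])
  have G_0: "G (T 0) = 0"
    by (simp add: G_def growth_exponent_def visits_0 [OF sig])
  obtain C where C: "\<And>k. G (T k) \<le> C"
    using Limsup_neg_imp_bounded_sequence [OF assms(14) T(3)] unfolding G_def by blast
  obtain a b where a: "a > 0" "\<And>p v. p \<in> P \<Longrightarrow> a * (norm v)\<^sup>2 \<le> qform (Qm p) v"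
    and b: "b > 0" "\<And>p v. p \<in> P \<Longrightarrow> qform (Qm p) v \<le> b * (norm v)\<^sup>2"
    using pos_def_uniform_bounds [OF assms(1), of Qm] assms(4) by blast

  \<comment> \<open>The rate \<open>c\<close> is \<open>- lam p\<close> or \<open>mu p\<close> for
    the active \<open>p\<close>. Complete and partial intervals need separate bounds: the dwell time
    \<open>\<tau>\<close> of a stable index is guaranteed only on a complete interval, and before
    its end the exponent is merely at most 0.\<close>
  have rate: "\<exists>c. Qm (\<sigma> (T k)) ** A (\<sigma> (T k)) + transpose (A (\<sigma> (T k))) ** Qm (\<sigma> (T k)) \<preceq> c *\<^sub>R Qm (\<sigma> (T k))
      \<and> c * (T (Suc k) - T k) \<le> step k \<and> (\<forall>t\<in>{T k..<T (Suc k)}. c * (t - T k) \<le> B)" for k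
  proof (cases "\<sigma> (T k) \<in> stable_idx P A")
    case True
    let ?m = "Min (lam ` stable_idx P A)"
    have fin: "finite (lam ` stable_idx P A)"
      using assms(1) by (simp add: stable_idx_def)
    then have m: "?m \<le> lam (\<sigma> (T k))"
      using True by (intro Min_le) auto
    have "?m \<in> lam ` stable_idx P A"
      using fin True by (intro Min_in) auto
    then have "?m > 0"
      using assms(5) by auto
    then have "?m * \<tau> \<le> lam (\<sigma> (T k)) * (T (Suc k) - T k)"
      using m dwell(1) [OF True] assms(11) by (intro mult_mono) auto
    moreover have "lam (\<sigma> (T k)) * (t - T k) \<ge> 0" if "t \<in> {T k..<T (Suc k)}" for t
      using that assms(5) True by (simp add: less_imp_le)
    ultimately show ?thesis
      using True assms(8) by (intro exI [of _ "- lam (\<sigma> (T k))"])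
        (force simp: step_def step_exponent_def B_def le_max_iff_disj)
  next
    case False
    let ?m = "Max (mu ` unstable_idx P A)"
    have U: "\<sigma> (T k) \<in> unstable_idx P A"
      using False assms(2) \<sigma>TP [of k] by (auto simp: stable_idx_def unstable_idx_def)
    have fin: "finite (mu ` unstable_idx P A)"
      using assms(1) by (simp add: unstable_idx_def)
    have m: "mu (\<sigma> (T k)) \<le> ?m" "mu (\<sigma> (T k)) > 0"
      using fin U assms(6) by (auto intro: Max_ge)
    \<comment> \<open>Including the right endpoint lets one inequality serve both the complete
      interval and its initial pieces.\<close>
    have "mu (\<sigma> (T k)) * (t - T k) \<le> ?m * \<eta>" if "T k \<le> t" "t \<le> T (Suc k)" for t
      using m dwell(2) [OF U] that by (intro mult_mono) auto
    then show ?thesis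
      using U False assms(9) T_less [of k] by (intro exI [of _ "mu (\<sigma> (T k))"])
        (force simp: step_def step_exponent_def B_def le_max_iff_disj)
  qed

  \<comment> \<open>Stability from the bounds at the switching times\<close>
  show ?thesis
    unfolding stable_under_arbitrary_impulses_def stable_system_def
  proof (intro allI impI)
    fix \<omega> :: "real \<Rightarrow> 'q" and \<epsilon> :: real
    assume \<omega>: "\<omega> ` T ` {1..} \<subseteq> Q" and "\<epsilon> > 0"
    \<comment> \<open>Product of the losses along the way: \<open>b / a\<close> from comparing forms
      with norms at both ends, \<open>exp C\<close> from the complete intervals,
      \<open>exp B\<close> from the last, partial one. It depends neither on the trajectory nor on
      \<open>\<omega>\<close>.\<close>
    define K where "K = exp B * exp C * b / a"
    have "K > 0"
      using a(1) b(1) by (simp add: K_def)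
    have bound: "(norm (x t))\<^sup>2 \<le> K * (norm (x 0))\<^sup>2" if traj: "trajectory A J \<sigma> T \<omega> x" and "t \<ge> 0" for x t
    proof -
      define V where "V k = qform (Qm (\<sigma> (T k))) (x (T k))" for k
      have V_nonneg: "V k \<ge> 0" for k
        using assms(4) \<sigma>TP by (simp add: V_def pos_def_qform_nonneg)
      have flow: "\<exists>c. c * (T (Suc k) - T k) \<le> step k \<and> (\<forall>t\<in>{T k..<T (Suc k)}. c * (t - T k) \<le> B \<and>
          qform (Qm (\<sigma> (T k))) (x t) \<le> exp (c * (t - T k)) * V k)" for k
      proof -
        obtain c where c: "Qm (\<sigma> (T k)) ** A (\<sigma> (T k)) + transpose (A (\<sigma> (T k))) ** Qm (\<sigma> (T k)) \<preceq> c *\<^sub>R Qm (\<sigma> (T k))"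
          "c * (T (Suc k) - T k) \<le> step k" "\<forall>t\<in>{T k..<T (Suc k)}. c * (t - T k) \<le> B"
          using rate by blast
        have "\<And>t. t \<in> {T k..<T (Suc k)} \<Longrightarrow>
            (x has_vector_derivative A (\<sigma> t) *v x t) (at t within {T k..<T (Suc k)})"
          using traj unfolding trajectory_def by (metis One_nat_def diff_Suc_1 le_add1 plus_1_eq_Suc)
        then have "\<And>t. t \<in> {T k..<T (Suc k)} \<Longrightarrow>
            (x has_vector_derivative A (\<sigma> (T k)) *v x t) (at t within {T k..<T (Suc k)})"
          using switching_signal_constant [OF sig] by metis
        from qform_flow_bound [OF this c(1)] c show ?thesis
          unfolding V_def by blast
      qed
      have V_Suc: "V (Suc k) \<le> exp (step k + ln \<gamma>) * V k" for k
      proof -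
        obtain c where c: "c * (T (Suc k) - T k) \<le> step k"
          "\<And>t. t \<in> {T k..<T (Suc k)} \<Longrightarrow> qform (Qm (\<sigma> (T k))) (x t) \<le> exp (c * (t - T k)) * V k"
          using flow by blast
        obtain l where l: "(x \<longlongrightarrow> l) (at_left (T (Suc k)))" "x (T (Suc k)) = J (\<omega> (T (Suc k))) *v l"
          using traj unfolding trajectory_def by (metis le_add1 plus_1_eq_Suc)
        \<comment> \<open>At \<open>T (Suc k)\<close> the state has already jumped, so the flow
          bound is carried to the left limit \<open>l\<close> by continuity, still with the form of
          the old index.\<close>
        have "qform (Qm (\<sigma> (T k))) l \<le> exp (c * (T (Suc k) - T k)) * V k"
        proof (rule tendsto_le)
          show "((\<lambda>t. qform (Qm (\<sigma> (T k))) (x t)) \<longlongrightarrow> qform (Qm (\<sigma> (T k))) l) (at_left (T (Suc k)))"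
            by (rule tendsto_qform [OF l(1)])
          show "((\<lambda>t. exp (c * (t - T k)) * V k) \<longlongrightarrow> exp (c * (T (Suc k) - T k)) * V k) (at_left (T (Suc k)))"
            by (intro tendsto_intros)
          show "\<forall>\<^sub>F t in at_left (T (Suc k)). qform (Qm (\<sigma> (T k))) (x t) \<le> exp (c * (t - T k)) * V k"
            using eventually_at_left_real [OF T_less [of k]] by eventually_elim (auto intro: c(2))
        qed simp
        also have "\<dots> \<le> exp (step k) * V k"
          using c(1) V_nonneg by (intro mult_right_mono) auto
        finally have left: "qform (Qm (\<sigma> (T k))) l \<le> exp (step k) * V k" .
        let ?M = "J (\<omega> (T (Suc k)))"
        have "?M \<in> J ` Q"
          using \<omega> by (intro imageI) (auto simp: image_subset_iff)
        \<comment> \<open>In \<open>gam (q, p)\<close> the first index is the one left and the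
          second the one entered; evaluating at \<open>l\<close> compares the new form after the
          impulse with the old form before it.\<close>
        then have "transpose ?M ** Qm (\<sigma> (T (Suc k))) ** ?M
            \<preceq> gam (\<sigma> (T k), \<sigma> (T (Suc k))) *\<^sub>R Qm (\<sigma> (T k))"
          using assms(10) \<sigma>TP by blast
        from loewner_le_qform [OF this, of l]
        have "V (Suc k) \<le> gam (\<sigma> (T k), \<sigma> (T (Suc k))) * qform (Qm (\<sigma> (T k))) l"
          by (simp add: qform_congruence V_def l(2))
        also have "\<dots> \<le> \<gamma> * (exp (step k) * V k)"
          using left \<open>\<gamma> \<ge> 1\<close> gam_le [OF \<sigma>TP \<sigma>TP] assms(4) \<sigma>TP
          by (intro mult_mono) (auto simp: pos_def_qform_nonneg)
        finally show ?thesis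
          using \<open>\<gamma> \<ge> 1\<close> by (simp add: exp_add mult_ac)
      qed
      have V_le: "V k \<le> exp (G (T k)) * V 0" for k
      proof (induction k)
        case 0
        show ?case by (simp add: G_0)
      next
        case (Suc k)
        have "V (Suc k) \<le> exp (step k + ln \<gamma>) * (exp (G (T k)) * V 0)"
          using V_Suc [of k] Suc by (meson exp_ge_zero mult_left_mono order_trans)
        also have "\<dots> = exp (G (T (Suc k))) * V 0"
          by (simp add: G_Suc exp_add mult_ac)
        finally show ?case .
      qed
      \<comment> \<open>The time \<open>t\<close> may fall inside an interval, so the last stretch
        from \<open>T k\<close> to \<open>t\<close> is charged to \<open>B\<close> and not to
        \<open>step k\<close>.\<close>
      obtain k where k: "t \<in> {T k..<T (Suc k)}"
        using switching_interval_exists [of T t] T \<open>t \<ge> 0\<close> by auto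
      obtain c where c: "c * (t - T k) \<le> B" "qform (Qm (\<sigma> (T k))) (x t) \<le> exp (c * (t - T k)) * V k"
        using flow k by blast
      have "a * (norm (x t))\<^sup>2 \<le> exp (c * (t - T k)) * V k"
        using a(2) [OF \<sigma>TP] c(2) by (rule order_trans)
      also have "\<dots> \<le> exp B * V k"
        using c(1) V_nonneg by (intro mult_right_mono) auto
      also have "\<dots> \<le> exp B * (exp C * V 0)"
      proof -
        have "exp (G (T k)) * V 0 \<le> exp C * V 0"
          using C V_nonneg by (intro mult_right_mono) auto
        with V_le [of k] show ?thesis by simp
      qed
      also have "\<dots> \<le> exp B * (exp C * (b * (norm (x 0))\<^sup>2))"
        using b(2) [OF \<sigma>TP, of 0 "x 0"] T(1) by (simp add: V_def)
      finally show ?thesis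
        using a(1) by (simp add: K_def field_simps)
    qed
    \<comment> \<open>Since \<open>K\<close> bounds squared norms, the witness is
      \<open>\<delta> = \<epsilon> / sqrt K\<close>.\<close>
    have "norm (x t) < \<epsilon>"
      if "trajectory A J \<sigma> T \<omega> x" "norm (x 0) < \<epsilon> / sqrt K" "t > 0" for x t
    proof -
      have "(norm (x 0))\<^sup>2 < (\<epsilon> / sqrt K)\<^sup>2"
        using that by (intro power_strict_mono) auto
      then have "K * (norm (x 0))\<^sup>2 < \<epsilon>\<^sup>2"
        using \<open>K > 0\<close> by (simp add: power_divide field_simps)
      with bound [OF that(1), of t] that(3) have "(norm (x t))\<^sup>2 < \<epsilon>\<^sup>2"
        by simp
      then show ?thesis
        using \<open>\<epsilon> > 0\<close> by (simp add: power2_less_imp_less)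
    qed
    moreover have "\<epsilon> / sqrt K > 0"
      using \<open>\<epsilon> > 0\<close> \<open>K > 0\<close> by simp
    ultimately show "\<exists>\<delta>>0. \<forall>x. trajectory A J \<sigma> T \<omega> x \<longrightarrow> norm (x 0) < \<delta> \<longrightarrow> (\<forall>t>0. norm (x t) < \<epsilon>)"
      by blast
  qed
qed

end
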